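(* Let $\mathbb{X}$ be a $3$-dimensional real polyhedral Banach space (that is, $\mathbb{R}^3$ with a norm) such that $B_{\mathbb{X}}$ is the polyhedron obtained by gluing two pyramids at the opposite base faces of a right prism having square base, with vertices $$\pm(1,1,1),\ \pm(-1,1,1),\ \pm(-1,-1,1),\ \pm(1,-1,1),\ \pm(0,0,2).$$ Then $n(\mathbb{X})=\frac12$.
   Context: All Banach spaces are real. For a Banach space $\mathbb{X}$, $B_{\mathbb{X}}$ and $S_{\mathbb{X}}$ are its closed unit ball and unit sphere, $\mathbb{X}^*$ is the dual space, and $L(\mathbb{X})$ is the space of bounded linear operators on $\mathbb{X}$ with the operator norm. For $T\in L(\mathbb{X})$ the numerical radius is $v(T)=\sup\{|x^*(Tx)|: x\in S_{\mathbb{X}},\ x^*\in S_{\mathbb{X}^*},\ x^*(x)=1\}$, and the numerical index is $n(\mathbb{X})=\inf\{v(T):T\in L(\mathbb{X}),\ \|T\|=1\}$. A finite-dimensional Banach space is polyhedral if its unit ball has only finitely many extreme points (its vertices); the unit ball is then the convex hull of its vertices. *)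

theory Defs
  imports "HOL-Analysis.Analysis"
begin

(* Both Sup and Inf below are taken in the reals; for a nontrivial space the sets are nonempty
   (by Hahn-Banach for the radius) and bounded, so no junk value is involved. *)

definition numerical_radius :: "('a::real_normed_vector \<Rightarrow>\<^sub>L 'a) \<Rightarrow> real" where
  "numerical_radius T =
     Sup {\<bar>blinfun_apply x' (blinfun_apply T x)\<bar> | (x::'a) (x'::'a \<Rightarrow>\<^sub>L real).
            norm x = 1 \<and> norm x' = 1 \<and> blinfun_apply x' x = 1}"

definition numerical_index :: "'a::real_normed_vector itself \<Rightarrow> real" where
  "numerical_index TYPE('a) =
     Inf {numerical_radius T | T :: 'a \<Rightarrow>\<^sub>L 'a. norm T = 1}"

definition unit_ball_vertices :: "'a::real_normed_vector set" where
  "unit_ball_vertices = {x. x extreme_point_of cball 0 1}"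

(* Meant for finite-dimensional spaces only; the dimension is not part of the predicate. *)
definition polyhedral :: "'a::real_normed_vector itself \<Rightarrow> bool" where
  "polyhedral TYPE('a) \<longleftrightarrow> finite (unit_ball_vertices :: 'a set)"

(* The prism is the cube with vertices (+-1, +-1, +-1); the apexes of the two pyramids are
   (0, 0, +-2). *)

definition bipyramidal_prism_vertices :: "(real ^ 3) set" where
  "bipyramidal_prism_vertices =
     (let V = {vector [1, 1, 1], vector [-1, 1, 1], vector [-1, -1, 1], vector [1, -1, 1],
               vector [0, 0, 2]}
      in V \<union> uminus ` V)"

end

theory Submission
  imports Defs
begin

text \<open>
  Identify the space with \<open>\<real>\<^sup>3\<close> through \<open>coord\<close>. Its unit ball is a compact convex body whose
  extreme points are given, so by Krein--Milman--Minkowski the ball is the convex hull of these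
  ten points. Its facets are \<open>\<plusminus>x = 1\<close>, \<open>\<plusminus>y = 1\<close>, \<open>\<plusminus>x \<plusminus> z = 2\<close> and \<open>\<plusminus>y \<plusminus> z = 2\<close>, and the norm is
  the maximum of the corresponding functionals.

  \<^emph>\<open>Lower bound.\<close> Every pair of a vertex \<open>p\<close> and a facet functional \<open>w\<close> with \<open>w p = 1\<close> gives
  \<open>\<bar>w (T p)\<bar> \<le> v(T)\<close>. Write \<open>T\<close> as a \<open>3 \<times> 3\<close> matrix with rows \<open>(a,b,c)\<close>, \<open>(d,e,f)\<close>, \<open>(g,h,k)\<close> and
  put \<open>v = v(T)\<close>. Running through all choices of signs, the facets \<open>\<plusminus>x = 1\<close> give
  \<open>\<bar>a\<bar> + \<bar>b\<bar> + \<bar>c\<bar> \<le> v\<close>; the apex gives \<open>\<bar>c\<bar> + \<bar>k\<bar> \<le> v\<close>; and the facets \<open>\<plusminus>x \<plusminus> z = 2\<close> at the vertices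
  of the cube give \<open>\<bar>c + g\<bar> + \<bar>h\<bar> \<le> 2v\<close>. The last two yield \<open>\<bar>g\<bar> + \<bar>h\<bar> + \<bar>k\<bar> \<le> 3v\<close>. Hence at a vertex
  of the cube the image under \<open>T\<close> has, in modulus, first coordinate at most \<open>v\<close> and third coordinate
  at most \<open>3v\<close>, and likewise with the second coordinate, so its norm is at most \<open>2v\<close>; the same bound holds
  at the apex. By convexity \<open>\<parallel>T\<parallel> \<le> 2v\<close>.

  \<^emph>\<open>Upper bound.\<close> Equality in these estimates is attained by the operator
  \<open>(x,y,z) \<mapsto> (-z/2, -z/2, x + y/2)\<close>. It has norm \<open>1\<close>, and its numerical radius is at most \<open>1/2\<close>
  because \<open>\<parallel>I \<plusminus> T/4\<parallel> \<le> 1 + 1/8\<close>.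
\<close>

section \<open>Estimates of the numerical radius\<close>

lemma abs_le_numerical_radius:
  fixes T :: "'a::real_normed_vector \<Rightarrow>\<^sub>L 'a"
  assumes "norm x = 1" "norm x' = 1" "blinfun_apply x' x = 1"
  shows "\<bar>blinfun_apply x' (blinfun_apply T x)\<bar> \<le> numerical_radius T"
proof -
  let ?R = "{\<bar>blinfun_apply x' (blinfun_apply T x)\<bar> |(x :: 'a) (x' :: 'a \<Rightarrow>\<^sub>L real).
      norm x = 1 \<and> norm x' = 1 \<and> blinfun_apply x' x = 1}"
  have "\<bar>blinfun_apply y' (blinfun_apply T y)\<bar> \<le> norm T"
    if "norm y = 1" "norm y' = 1" for y and y' :: "'a \<Rightarrow>\<^sub>L real"
    using norm_blinfun[of y' "blinfun_apply T y"] norm_blinfun[of T y] that by simp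
  then have "bdd_above ?R"
    by (auto intro!: bdd_aboveI[where M = "norm T"])
  moreover have "\<bar>blinfun_apply x' (blinfun_apply T x)\<bar> \<in> ?R"
    using assms by blast
  ultimately show ?thesis
    unfolding numerical_radius_def by (intro cSup_upper)
qed

text \<open>
  If \<open>x'\<close> attains its norm at \<open>x\<close>, then \<open>1 \<plusminus> t x'(T x) = x'(x \<plusminus> t T x) \<le> \<parallel>x \<plusminus> t T x\<parallel>\<close>. So a
  bound on the norm of \<open>I \<plusminus> t T\<close> bounds the numerical radius with no description of the supporting
  functionals. The supremum over an empty set being arbitrary, one supporting pair has to be given.
\<close>
lemma numerical_radius_le:
  fixes T :: "'a::real_normed_vector \<Rightarrow>\<^sub>L 'a" and x\<^sub>0' :: "'a \<Rightarrow>\<^sub>L real"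
  assumes pair: "norm x\<^sub>0 = 1" "norm x\<^sub>0' = 1" "blinfun_apply x\<^sub>0' x\<^sub>0 = 1"
    and "t > 0"
    and plus: "\<And>x. norm x = 1 \<Longrightarrow> norm (x + t *\<^sub>R blinfun_apply T x) \<le> 1 + t * c"
    and minus: "\<And>x. norm x = 1 \<Longrightarrow> norm (x - t *\<^sub>R blinfun_apply T x) \<le> 1 + t * c"
  shows "numerical_radius T \<le> c"
  unfolding numerical_radius_def
proof (rule cSup_least)
  let ?R = "{\<bar>blinfun_apply x' (blinfun_apply T x)\<bar> |(x :: 'a) (x' :: 'a \<Rightarrow>\<^sub>L real).
      norm x = 1 \<and> norm x' = 1 \<and> blinfun_apply x' x = 1}"
  have "\<bar>blinfun_apply x\<^sub>0' (blinfun_apply T x\<^sub>0)\<bar> \<in> ?R"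
    using pair by blast
  then show "?R \<noteq> {}"
    by (metis empty_iff)
  fix r
  assume "r \<in> ?R"
  then obtain x and x' :: "'a \<Rightarrow>\<^sub>L real"
    where r: "r = \<bar>blinfun_apply x' (blinfun_apply T x)\<bar>"
      and x: "norm x = 1" "norm x' = 1" "blinfun_apply x' x = 1"
    by blast
  have "1 + t * blinfun_apply x' (blinfun_apply T x) \<le> 1 + t * c"
    using norm_blinfun[of x' "x + t *\<^sub>R blinfun_apply T x"] plus[OF x(1)] x
    by (simp add: blinfun.bilinear_simps)
  moreover have "1 - t * blinfun_apply x' (blinfun_apply T x) \<le> 1 + t * c"
    using norm_blinfun[of x' "x - t *\<^sub>R blinfun_apply T x"] minus[OF x(1)] x
    by (simp add: blinfun.bilinear_simps)
  ultimately have "t * r \<le> t * c"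
    unfolding r by (auto simp: abs_if)
  then show "r \<le> c"
    using \<open>t > 0\<close> by simp
qed

section \<open>Unit balls determined by their extreme points\<close>

lemma linear_inv:
  assumes "linear f" "bij f"
  shows "linear (inv f)"
proof (rule linearI)
  have inv: "inv f (f p) = p" "f (inv f x) = x" for p x
    using assms(2) by (simp_all add: bij_is_inj bij_is_surj surj_f_inv_f)
  show "inv f (x + y) = inv f x + inv f y" for x y
    by (metis inv linear_add[OF assms(1)])
  show "inv f (r *\<^sub>R x) = r *\<^sub>R inv f x" for r x
    by (metis inv linear_scale[OF assms(1)])
qed

lemma linear_inj_bounded_below:
  fixes f :: "'e::euclidean_space \<Rightarrow> 'a::real_normed_vector"
  assumes "linear f" "inj f"
  obtains B where "B > 0" "\<And>x. B * norm x \<le> norm (f x)"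
proof -
  have cont: "continuous_on (sphere 0 1) (\<lambda>x. norm (f x))"
    using assms(1) by (intro continuous_on_norm linear_continuous_on)
      (simp add: linear_conv_bounded_linear)
  obtain z :: 'e where z: "norm z = 1"
    using vector_choose_size[of 1] by auto
  obtain m where m: "norm m = 1" and le: "\<And>y. norm y = 1 \<Longrightarrow> norm (f m) \<le> norm (f y)"
    using continuous_attains_inf[OF _ _ cont] z by auto
  have "f m \<noteq> 0"
    using m assms linear_injective_0[of f] by auto
  show thesis
  proof (rule that[of "norm (f m)"])
    show "norm (f m) > 0"
      using \<open>f m \<noteq> 0\<close> by simp
    fix x
    show "norm (f m) * norm x \<le> norm (f x)"
    proof (cases "x = 0")
      case False
      have "norm (f m) \<le> norm (f ((1 / norm x) *\<^sub>R x))"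
        using False by (intro le) simp
      then show ?thesis
        using False by (simp add: linear_scale[OF assms(1)] field_simps)
    qed simp
  qed
qed

text \<open>
  The Krein--Milman--Minkowski theorem is about Euclidean spaces, so it is applied to the preimage
  of the ball, which is compact because a linear injection of a Euclidean space is bounded from
  above and from below; extreme points correspond under a linear bijection.
\<close>
lemma unit_ball_eq_convex_hull:
  fixes f :: "'e::euclidean_space \<Rightarrow> 'a::real_normed_vector"
  assumes lin: "linear f" and bij: "bij f"
    and ext: "{x. x extreme_point_of cball 0 1} = f ` V"
  shows "{p. norm (f p) \<le> 1} = convex hull V"
proof -
  let ?B = "{p. norm (f p) \<le> 1}"
  have inj: "inj f"
    using bij by (rule bij_is_inj)
  have image: "f ` ?B = cball 0 1"
    using bij_is_surj[OF bij] by (auto simp: image_iff) (metis surjD)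
  have "p extreme_point_of ?B \<longleftrightarrow> p \<in> V" for p
  proof -
    have "p extreme_point_of ?B \<longleftrightarrow> f ` {p} face_of f ` ?B"
      by (simp only: face_of_linear_image[OF lin inj] face_of_singleton)
    also have "\<dots> \<longleftrightarrow> f p \<in> {x. x extreme_point_of cball 0 1}"
      by (simp add: image face_of_singleton)
    also have "\<dots> \<longleftrightarrow> p \<in> V"
      by (simp only: ext inj_image_mem_iff[OF inj])
    finally show ?thesis .
  qed
  moreover have "convex ?B"
    using convex_linear_vimage[OF lin convex_cball[of 0 1]] by (simp add: vimage_def)
  moreover have "compact ?B"
  proof (rule compact_eq_bounded_closed[THEN iffD2], rule conjI)
    obtain b where b: "b > 0" "\<And>x. b * norm x \<le> norm (f x)"
      using linear_inj_bounded_below[OF lin inj] by blast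
    have "norm p \<le> 1 / b" if "p \<in> ?B" for p
      using b(2)[of p] b(1) that by (simp add: field_simps)
    then show "bounded ?B"
      by (rule boundedI)
    have "continuous_on UNIV (\<lambda>p. norm (f p))"
      using lin by (intro continuous_on_norm linear_continuous_on)
        (simp add: linear_conv_bounded_linear)
    then show "closed ?B"
      by (intro closed_Collect_le continuous_on_const)
  qed
  ultimately show ?thesis
    using Krein_Milman_Minkowski[of ?B] by simp
qed

section \<open>The norm whose unit ball is the bipyramidal prism\<close>

definition prism_norm :: "real ^ 3 \<Rightarrow> real" where
  "prism_norm p =
     max (max \<bar>p $ 1\<bar> \<bar>p $ 2\<bar>) ((max \<bar>p $ 1\<bar> \<bar>p $ 2\<bar> + \<bar>p $ 3\<bar>) / 2)"

lemma prism_norm_le_iff: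
  "prism_norm p \<le> c \<longleftrightarrow>
     \<bar>p $ 1\<bar> \<le> c \<and> \<bar>p $ 2\<bar> \<le> c \<and> \<bar>p $ 1\<bar> + \<bar>p $ 3\<bar> \<le> 2 * c \<and> \<bar>p $ 2\<bar> + \<bar>p $ 3\<bar> \<le> 2 * c"
  unfolding prism_norm_def by (auto simp: max_def)

lemma prism_norm_le_iff_halfspaces:
  "prism_norm p \<le> c \<longleftrightarrow>
     p $ 1 \<le> c \<and> - p $ 1 \<le> c \<and> p $ 2 \<le> c \<and> - p $ 2 \<le> c \<and>
     p $ 1 + p $ 3 \<le> 2 * c \<and> p $ 1 - p $ 3 \<le> 2 * c \<and>
     - p $ 1 + p $ 3 \<le> 2 * c \<and> - p $ 1 - p $ 3 \<le> 2 * c \<and>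
     p $ 2 + p $ 3 \<le> 2 * c \<and> p $ 2 - p $ 3 \<le> 2 * c \<and>
     - p $ 2 + p $ 3 \<le> 2 * c \<and> - p $ 2 - p $ 3 \<le> 2 * c"
proof -
  have "\<bar>a\<bar> + \<bar>b\<bar> \<le> c \<longleftrightarrow> a + b \<le> c \<and> a - b \<le> c \<and> - a + b \<le> c \<and> - a - b \<le> c"
    for a b c :: real
    by linarith
  then show ?thesis
    unfolding prism_norm_le_iff abs_le_iff by auto
qed

lemma prism_norm_nonneg: "0 \<le> prism_norm p"
  unfolding prism_norm_def by (auto simp: max_def)

lemma prism_norm_scaleR: "prism_norm (r *\<^sub>R p) = \<bar>r\<bar> * prism_norm p"
proof -
  define m where "m = max \<bar>p $ 1\<bar> \<bar>p $ 2\<bar>"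
  have max_mult: "max (\<bar>r\<bar> * a) (\<bar>r\<bar> * b) = \<bar>r\<bar> * max a b" for a b
    by (simp add: max_mult_distrib_left)
  have "prism_norm (r *\<^sub>R p) = max (\<bar>r\<bar> * m) (\<bar>r\<bar> * ((m + \<bar>p $ 3\<bar>) / 2))"
    unfolding prism_norm_def by (simp add: abs_mult max_mult m_def distrib_left)
  also have "\<dots> = \<bar>r\<bar> * prism_norm p"
    unfolding max_mult prism_norm_def m_def ..
  finally show ?thesis .
qed

lemma convex_prism_norm_ball: "convex {p. prism_norm p \<le> 1}"
proof -
  have "{p. prism_norm p \<le> 1} =
      {p. vector [1, 0, 0] \<bullet> p \<le> 1} \<inter> {p. vector [-1, 0, 0] \<bullet> p \<le> 1} \<inter>
      {p. vector [0, 1, 0] \<bullet> p \<le> 1} \<inter> {p. vector [0, -1, 0] \<bullet> p \<le> 1} \<inter>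
      {p. vector [1, 0, 1] \<bullet> p \<le> 2} \<inter> {p. vector [1, 0, -1] \<bullet> p \<le> 2} \<inter>
      {p. vector [-1, 0, 1] \<bullet> p \<le> 2} \<inter> {p. vector [-1, 0, -1] \<bullet> p \<le> 2} \<inter>
      {p. vector [0, 1, 1] \<bullet> p \<le> 2} \<inter> {p. vector [0, 1, -1] \<bullet> p \<le> 2} \<inter>
      {p. vector [0, -1, 1] \<bullet> p \<le> 2} \<inter> {p. vector [0, -1, -1] \<bullet> p \<le> (2::real)}"
    by (auto simp: prism_norm_le_iff_halfspaces inner_vec_def sum_3)
  then show ?thesis
    by (simp only:) (intro convex_Int convex_halfspace_le)
qed

lemma bipyramidal_prism_vertices_eq:
  "bipyramidal_prism_vertices =
     {vector [s, t, u] | s t u. \<bar>s\<bar> = 1 \<and> \<bar>t\<bar> = 1 \<and> \<bar>u\<bar> = 1} \<union>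
     {vector [0, 0, s] | s. \<bar>s\<bar> = 2}"
proof -
  have neg: "- (vector [a, b, c] :: real ^ 3) = vector [- a, - b, - c]" for a b c
    by (simp add: vec_eq_iff forall_3)
  have abs: "\<bar>s\<bar> = c \<longleftrightarrow> s = c \<or> s = - c" if "c \<ge> 0" for s c :: real
    using that by auto
  show ?thesis
    unfolding bipyramidal_prism_vertices_def Let_def
    by (auto simp: neg abs)
qed

text \<open>
  A point of the cube is reached from the vertices by moving along one coordinate at a time. A point
  \<open>(x, y, z)\<close> with \<open>1 < \<bar>z\<bar> < 2\<close> lies on the segment from an apex to a point of the cube at height
  \<open>\<plusminus>1\<close>, namely its projection from that apex.
\<close>
lemma convex_hull_bipyramidal_prism:
  "convex hull bipyramidal_prism_vertices = {p. prism_norm p \<le> 1}"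
proof
  show "convex hull bipyramidal_prism_vertices \<subseteq> {p. prism_norm p \<le> 1}"
    by (intro hull_minimal convex_prism_norm_ball)
      (auto simp: bipyramidal_prism_vertices_eq prism_norm_le_iff)
next
  let ?H = "convex hull bipyramidal_prism_vertices"
  have mix: "(1 - r) *\<^sub>R p + r *\<^sub>R q \<in> ?H" if "p \<in> ?H" "q \<in> ?H" "0 \<le> r" "r \<le> 1" for p q r
    using that convexD[OF convex_convex_hull that(1,2), of "1 - r" r] by simp
  have corner: "vector [s, t, u] \<in> ?H" if "\<bar>s\<bar> = 1" "\<bar>t\<bar> = 1" "\<bar>u\<bar> = 1" for s t u
    using that by (intro hull_inc) (auto simp: bipyramidal_prism_vertices_eq)
  have apex: "vector [0, 0, s] \<in> ?H" if "\<bar>s\<bar> = 2" for s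
    using that by (intro hull_inc) (auto simp: bipyramidal_prism_vertices_eq)
  have edge: "vector [x, t, u] \<in> ?H" if "\<bar>x\<bar> \<le> 1" "\<bar>t\<bar> = 1" "\<bar>u\<bar> = 1" for x t u
  proof -
    have "vector [x, t, u] = (1 - (1 + x) / 2) *\<^sub>R vector [-1, t, u] +
        ((1 + x) / 2) *\<^sub>R (vector [1, t, u] :: real ^ 3)"
      by (simp add: vec_eq_iff forall_3 field_simps)
    then show ?thesis
      using that by (simp only:) (intro mix corner; simp)
  qed
  have face: "vector [x, y, u] \<in> ?H" if "\<bar>x\<bar> \<le> 1" "\<bar>y\<bar> \<le> 1" "\<bar>u\<bar> = 1" for x y u
  proof -
    have "vector [x, y, u] = (1 - (1 + y) / 2) *\<^sub>R vector [x, -1, u] +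
        ((1 + y) / 2) *\<^sub>R (vector [x, 1, u] :: real ^ 3)"
      by (simp add: vec_eq_iff forall_3 field_simps)
    then show ?thesis
      using that by (simp only:) (intro mix edge; simp)
  qed
  have cube: "vector [x, y, z] \<in> ?H" if "\<bar>x\<bar> \<le> 1" "\<bar>y\<bar> \<le> 1" "\<bar>z\<bar> \<le> 1" for x y z
  proof -
    have "vector [x, y, z] = (1 - (1 + z) / 2) *\<^sub>R vector [x, y, -1] +
        ((1 + z) / 2) *\<^sub>R (vector [x, y, 1] :: real ^ 3)"
      by (simp add: vec_eq_iff forall_3 field_simps)
    then show ?thesis
      using that by (simp only:) (intro mix face; simp)
  qed
  show "{p. prism_norm p \<le> 1} \<subseteq> ?H"
  proof
    fix p :: "real ^ 3"
    assume "p \<in> {p. prism_norm p \<le> 1}"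
    then have p: "\<bar>p $ 1\<bar> \<le> 1" "\<bar>p $ 2\<bar> \<le> 1"
      "\<bar>p $ 1\<bar> + \<bar>p $ 3\<bar> \<le> 2" "\<bar>p $ 2\<bar> + \<bar>p $ 3\<bar> \<le> 2"
      by (auto simp: prism_norm_le_iff)
    have p_eq: "p = vector [p $ 1, p $ 2, p $ 3]"
      by (simp add: vec_eq_iff forall_3)
    define d where "d = 2 - \<bar>p $ 3\<bar>"
    consider "\<bar>p $ 3\<bar> \<le> 1" | "d = 0" | "0 < d" "d < 1"
      using p unfolding d_def by linarith
    then show "p \<in> ?H"
    proof cases
      case 1
      then show ?thesis
        using cube p p_eq by metis
    next
      case 2
      then have "p $ 1 = 0" "p $ 2 = 0" "\<bar>p $ 3\<bar> = 2"
        using p by (auto simp: d_def)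
      then show ?thesis
        using apex p_eq by metis
    next
      case 3
      define e where "e = sgn (p $ 3)"
      have e: "\<bar>e\<bar> = 1" "p $ 3 = e * (2 - d)"
        using 3 by (auto simp: e_def d_def sgn_if)
      have "p = (1 - d) *\<^sub>R vector [0, 0, 2 * e] + d *\<^sub>R vector [p $ 1 / d, p $ 2 / d, e]"
        using 3 e by (simp add: vec_eq_iff forall_3 algebra_simps)
      moreover have "\<bar>p $ 1 / d\<bar> \<le> 1" "\<bar>p $ 2 / d\<bar> \<le> 1"
        using 3 p by (auto simp: d_def)
      ultimately show ?thesis
        using mix[OF apex face, of "2 * e" "p $ 1 / d" "p $ 2 / d" e d] 3 e(1)
        by (simp add: abs_mult)
    qed
  qed
qed

text \<open>
  Scaling turns equality of the unit balls into equality of all balls of positive radius. Comparing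
  these also settles the points where one of the functions vanishes.
\<close>
lemma homogeneous_eq_of_same_unit_ball:
  fixes f g :: "'e::real_vector \<Rightarrow> real"
  assumes f: "\<And>r p. f (r *\<^sub>R p) = \<bar>r\<bar> * f p" and g: "\<And>r p. g (r *\<^sub>R p) = \<bar>r\<bar> * g p"
    and "\<And>p. 0 \<le> f p" "\<And>p. 0 \<le> g p"
    and ball: "\<And>p. f p \<le> 1 \<longleftrightarrow> g p \<le> 1"
  shows "f p = g p"
proof -
  have le_iff: "f p \<le> c \<longleftrightarrow> g p \<le> c" if "c > 0" for c
    using ball[of "(1 / c) *\<^sub>R p"] that by (simp add: f g)
  show ?thesis
  proof (rule order_antisym; rule field_le_epsilon)
    fix e :: real
    assume "e > 0"
    then show "f p \<le> g p + e"
      using le_iff[of "g p + e"] assms(4)[of p] by simp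
    show "g p \<le> f p + e"
      using le_iff[of "f p + e"] assms(3)[of p] \<open>e > 0\<close> by simp
  qed
qed

lemma norm_eq_prism_norm:
  fixes f :: "real ^ 3 \<Rightarrow> 'a::real_normed_vector"
  assumes "linear f" "bij f"
    and "{x. x extreme_point_of cball 0 1} = f ` bipyramidal_prism_vertices"
  shows "norm (f p) = prism_norm p"
proof (rule homogeneous_eq_of_same_unit_ball[where f = "\<lambda>p. norm (f p)"])
  have "{p. norm (f p) \<le> 1} = {p. prism_norm p \<le> 1}"
    using unit_ball_eq_convex_hull[OF assms] convex_hull_bipyramidal_prism by simp
  then show "norm (f p) \<le> 1 \<longleftrightarrow> prism_norm p \<le> 1" for p
    by blast
qed (simp_all add: linear_scale[OF assms(1)] prism_norm_scaleR prism_norm_nonneg)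

section \<open>The lower bound\<close>

text \<open>
  For fixed \<open>\<alpha>\<close>, half the difference of the values at \<open>\<beta> = 1\<close> and \<open>\<beta> = -1\<close> is \<open>q + \<alpha> r\<close>, and the
  larger of \<open>\<bar>q + r\<bar>\<close> and \<open>\<bar>q - r\<bar>\<close> is \<open>\<bar>q\<bar> + \<bar>r\<bar>\<close>.
\<close>
lemma abs_add_abs_le_of_signs:
  fixes m n q r v :: real
  assumes "\<And>\<alpha> \<beta>. \<bar>\<alpha>\<bar> = 1 \<Longrightarrow> \<bar>\<beta>\<bar> = 1 \<Longrightarrow> \<bar>m + \<alpha> * n + \<beta> * q + \<alpha> * \<beta> * r\<bar> \<le> 2 * v"
  shows "\<bar>q\<bar> + \<bar>r\<bar> \<le> 2 * v"
  using assms[of 1 1] assms[of 1 "-1"] assms[of "-1" 1] assms[of "-1" "-1"] by simp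

lemma sum_abs_le_of_signs:
  fixes m n q v :: real
  assumes "\<And>\<alpha> \<beta>. \<bar>\<alpha>\<bar> = 1 \<Longrightarrow> \<bar>\<beta>\<bar> = 1 \<Longrightarrow> \<bar>m + \<alpha> * n + \<beta> * q\<bar> \<le> v"
  shows "\<bar>m\<bar> + \<bar>n\<bar> + \<bar>q\<bar> \<le> v"
proof -
  have "\<bar>m + n + q\<bar> \<le> v" "\<bar>m + n - q\<bar> \<le> v" "\<bar>m - n + q\<bar> \<le> v" "\<bar>m - n - q\<bar> \<le> v"
    using assms[of 1 1] assms[of 1 "-1"] assms[of "-1" 1] assms[of "-1" "-1"] by simp_all
  then show ?thesis
    by (simp only: abs_le_iff) linarith
qed

text \<open>
  The hypothesis says that every functional supporting the ball at \<open>p\<close> has modulus at most \<open>v\<close> at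
  the image of \<open>p\<close>. It is used only at the facets containing a vertex, where it is a family of
  linear inequalities between the matrix entries.
\<close>
lemma vertex_image_bound:
  fixes M :: "real ^ 3 ^ 3"
  assumes radius: "\<And>w p. (\<And>q. \<bar>w \<bullet> q\<bar> \<le> prism_norm q) \<Longrightarrow> w \<bullet> p = 1 \<Longrightarrow> prism_norm p \<le> 1
      \<Longrightarrow> \<bar>w \<bullet> (M *v p)\<bar> \<le> v"
    and p: "p \<in> bipyramidal_prism_vertices"
  shows "prism_norm (M *v p) \<le> 2 * v"
proof -
  define a b c where "a = M $ 1 $ 1" and "b = M $ 1 $ 2" and "c = M $ 1 $ 3"
  define d e f where "d = M $ 2 $ 1" and "e = M $ 2 $ 2" and "f = M $ 2 $ 3"
  define g h k where "g = M $ 3 $ 1" and "h = M $ 3 $ 2" and "k = M $ 3 $ 3"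
  have M: "(M *v q) $ 1 = a * q $ 1 + b * q $ 2 + c * q $ 3"
    "(M *v q) $ 2 = d * q $ 1 + e * q $ 2 + f * q $ 3"
    "(M *v q) $ 3 = g * q $ 1 + h * q $ 2 + k * q $ 3" for q
    by (simp_all add: matrix_vector_mult_def sum_3 a_def b_def c_def d_def e_def f_def
        g_def h_def k_def)
  have dot: "vector [x, y, z] \<bullet> q = x * q $ 1 + y * q $ 2 + z * q $ 3" for x y z and q :: "real ^ 3"
    by (simp add: inner_vec_def sum_3)
  have prism_norm_ge: "\<bar>q $ 1\<bar> \<le> prism_norm q" "\<bar>q $ 2\<bar> \<le> prism_norm q"
    "\<bar>q $ 1\<bar> + \<bar>q $ 3\<bar> \<le> 2 * prism_norm q" "\<bar>q $ 2\<bar> + \<bar>q $ 3\<bar> \<le> 2 * prism_norm q" for q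
    using prism_norm_le_iff[of q "prism_norm q"] by auto
  have sgn_cases: "s = 1 \<or> s = -1" if "\<bar>s\<bar> = 1" for s :: real
    using that by auto
  \<comment> \<open>The functionals of the facets \<open>s x = 1\<close>, \<open>s y = 1\<close>, \<open>s x + u z = 2\<close> and \<open>s y + u z = 2\<close>.\<close>
  have facet: "\<bar>vector [s, 0, 0] \<bullet> q\<bar> \<le> prism_norm q" "\<bar>vector [0, s, 0] \<bullet> q\<bar> \<le> prism_norm q"
    "\<bar>vector [s / 2, 0, u / 2] \<bullet> q\<bar> \<le> prism_norm q"
    "\<bar>vector [0, s / 2, u / 2] \<bullet> q\<bar> \<le> prism_norm q"
    if "\<bar>s\<bar> = 1" "\<bar>u\<bar> = 1" for s u q
    using sgn_cases[OF that(1)] sgn_cases[OF that(2)] prism_norm_ge[of q]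
    by (auto simp: dot)
  have unit: "\<bar>s\<bar> = 1 \<Longrightarrow> \<bar>t\<bar> = 1 \<Longrightarrow> \<bar>u\<bar> = 1 \<Longrightarrow> prism_norm (vector [s, t, u]) \<le> 1"
    "prism_norm (vector [0, 0, 2]) \<le> 1" for s t u
    by (simp_all add: prism_norm_le_iff)
  \<comment> \<open>The bound does not change when a vertex and its facet are both negated, so one nonzero
    coordinate of the vertex may be taken to be positive.\<close>
  have row1: "\<bar>a + \<alpha> * b + \<beta> * c\<bar> \<le> v" if "\<bar>\<alpha>\<bar> = 1" "\<bar>\<beta>\<bar> = 1" for \<alpha> \<beta>
    using radius[of "vector [1, 0, 0]", OF facet(1)[of 1 1] _ unit(1)[of 1 \<alpha> \<beta>]] that
    by (simp add: dot M algebra_simps)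
  have row2: "\<bar>e + \<alpha> * d + \<beta> * f\<bar> \<le> v" if "\<bar>\<alpha>\<bar> = 1" "\<bar>\<beta>\<bar> = 1" for \<alpha> \<beta>
    using radius[of "vector [0, 1, 0]", OF facet(2)[of 1 1] _ unit(1)[of \<alpha> 1 \<beta>]] that
    by (simp add: dot M algebra_simps)
  have apex1: "\<bar>\<alpha> * c + k\<bar> \<le> v" if "\<bar>\<alpha>\<bar> = 1" for \<alpha>
    using radius[OF facet(3)[of \<alpha> 1] _ unit(2)] that by (simp add: dot M)
  have apex2: "\<bar>\<alpha> * f + k\<bar> \<le> v" if "\<bar>\<alpha>\<bar> = 1" for \<alpha>
    using radius[OF facet(4)[of \<alpha> 1] _ unit(2)] that by (simp add: dot M)
  have "\<bar>(a + k) + \<alpha> * b + \<beta> * (c + g) + \<alpha> * \<beta> * h\<bar> \<le> 2 * v" if "\<bar>\<alpha>\<bar> = 1" "\<bar>\<beta>\<bar> = 1" for \<alpha> \<beta>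
    using radius[OF facet(3)[of 1 \<beta>] _ unit(1)[of 1 \<alpha> \<beta>]] that
      sgn_cases[OF that(1)] sgn_cases[OF that(2)]
    by (auto simp: dot M abs_le_iff field_simps)
  then have mixed: "\<bar>c + g\<bar> + \<bar>h\<bar> \<le> 2 * v"
    by (rule abs_add_abs_le_of_signs)
  have rows: "\<bar>a\<bar> + \<bar>b\<bar> + \<bar>c\<bar> \<le> v" "\<bar>e\<bar> + \<bar>d\<bar> + \<bar>f\<bar> \<le> v"
    by (rule sum_abs_le_of_signs, rule row1; assumption)
      (rule sum_abs_le_of_signs, rule row2; assumption)
  have apexes: "\<bar>c\<bar> + \<bar>k\<bar> \<le> v" "\<bar>f\<bar> + \<bar>k\<bar> \<le> v"
    using apex1[of 1] apex1[of "-1"] apex2[of 1] apex2[of "-1"]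
    by (simp_all add: abs_if split: if_splits)
  have row3: "\<bar>g\<bar> + \<bar>h\<bar> + \<bar>k\<bar> \<le> 3 * v"
    using mixed apexes(1) by linarith
  consider s t u where "p = vector [s, t, u]" "\<bar>s\<bar> = 1" "\<bar>t\<bar> = 1" "\<bar>u\<bar> = 1"
    | s where "p = vector [0, 0, s]" "\<bar>s\<bar> = 2"
    using p by (auto simp: bipyramidal_prism_vertices_eq)
  then show ?thesis
  proof cases
    case 1
    have tri: "\<bar>x * s + y * t + z * u\<bar> \<le> \<bar>x\<bar> + \<bar>y\<bar> + \<bar>z\<bar>" for x y z
      using sgn_cases[OF 1(2)] sgn_cases[OF 1(3)] sgn_cases[OF 1(4)] by auto
    have "\<bar>a * s + b * t + c * u\<bar> \<le> v" "\<bar>d * s + e * t + f * u\<bar> \<le> v"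
      "\<bar>g * s + h * t + k * u\<bar> \<le> 3 * v"
      using order_trans[OF tri rows(1)] order_trans[OF tri, of d e f v] rows(2)
        order_trans[OF tri row3] by simp_all
    then show ?thesis
      unfolding prism_norm_le_iff M 1(1) vector_3 by - (intro conjI; linarith)
  next
    case 2
    then show ?thesis
      unfolding prism_norm_le_iff M
      using apexes by (simp add: abs_mult; intro conjI; linarith)
  qed
qed

lemma supporting_functional:
  fixes coord :: "real ^ 3 \<Rightarrow> 'a::real_normed_vector"
  assumes lin: "linear coord" and bij: "bij coord"
    and nrm: "\<And>p. norm (coord p) = prism_norm p"
    and w: "\<And>q. \<bar>w \<bullet> q\<bar> \<le> prism_norm q" "w \<bullet> p = 1" "prism_norm p \<le> 1"
  obtains x' where "norm (coord p) = 1" "norm x' = 1" "blinfun_apply x' (coord p) = 1"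
    "\<And>x. blinfun_apply x' x = w \<bullet> inv coord x"
proof -
  have np: "norm (coord p) = 1"
    using w(1)[of p] w(2,3) by (simp add: nrm)
  have inv_lin: "linear (inv coord)"
    using lin bij by (rule linear_inv)
  have coord_inv: "coord (inv coord x) = x" for x
    using bij by (simp add: bij_is_surj surj_f_inv_f)
  have bnd: "\<bar>w \<bullet> inv coord x\<bar> \<le> norm x" for x
    using w(1)[of "inv coord x"] nrm[of "inv coord x"] by (simp add: coord_inv)
  have "bounded_linear (\<lambda>x. w \<bullet> inv coord x)"
    using bnd by (intro bounded_linear_intro[where K = 1])
      (simp_all add: linear_add[OF inv_lin] linear_scale[OF inv_lin] inner_simps)
  then have ap: "blinfun_apply (Blinfun (\<lambda>x. w \<bullet> inv coord x)) = (\<lambda>x. w \<bullet> inv coord x)"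
    by (rule bounded_linear_Blinfun_apply)
  let ?x' = "Blinfun (\<lambda>x. w \<bullet> inv coord x)"
  have one: "blinfun_apply ?x' (coord p) = 1"
    using w(2) bij by (simp add: ap bij_is_inj)
  have "norm ?x' \<le> 1"
    by (rule norm_blinfun_bound) (simp_all add: ap bnd)
  moreover have "1 \<le> norm ?x'"
    using norm_blinfun[of ?x' "coord p"] by (simp add: one np)
  ultimately show thesis
    using np one ap by (intro that[of ?x']) auto
qed

text \<open>
  The set of points that \<open>T\<close> maps into the ball of radius \<open>2 v(T)\<close> is convex and contains the
  vertices, hence the whole unit ball.
\<close>
lemma norm_le_twice_numerical_radius:
  fixes coord :: "real ^ 3 \<Rightarrow> 'a::real_normed_vector" and T :: "'a \<Rightarrow>\<^sub>L 'a"
  assumes lin: "linear coord" and bij: "bij coord"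
    and nrm: "\<And>p. norm (coord p) = prism_norm p"
  shows "norm T \<le> 2 * numerical_radius T"
proof -
  let ?v = "numerical_radius T"
  define A where "A p = inv coord (blinfun_apply T (coord p))" for p
  have inv_lin: "linear (inv coord)"
    using lin bij by (rule linear_inv)
  have coord_inv: "coord (inv coord x) = x" for x
    using bij by (simp add: bij_is_surj surj_f_inv_f)
  have T_lin: "linear (\<lambda>p. blinfun_apply T (coord p))"
    using linear_compose[OF lin bounded_linear.linear[OF blinfun.bounded_linear_right]]
    by (simp add: o_def)
  have A_lin: "linear A"
    using linear_compose[OF T_lin inv_lin] by (simp add: A_def[abs_def] o_def)
  have A_mat: "A p = matrix A *v p" for p
    by (simp add: matrix_works A_lin linear_matrix_vector_mul_eq)
  have TA: "norm (blinfun_apply T (coord p)) = prism_norm (A p)" for p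
    using nrm[of "A p"] by (simp add: A_def coord_inv)
  have "\<bar>w \<bullet> (matrix A *v p)\<bar> \<le> ?v"
    if w: "\<And>q. \<bar>w \<bullet> q\<bar> \<le> prism_norm q" "w \<bullet> p = 1" "prism_norm p \<le> 1" for w p
  proof -
    obtain x' where x': "norm (coord p) = 1" "norm x' = 1" "blinfun_apply x' (coord p) = 1"
      and eq: "\<And>x. blinfun_apply x' x = w \<bullet> inv coord x"
      using supporting_functional[OF lin bij nrm w] by blast
    show ?thesis
      using abs_le_numerical_radius[OF x', of T] by (simp add: eq A_mat[symmetric] A_def)
  qed
  then have "prism_norm (matrix A *v p) \<le> 2 * ?v" if "p \<in> bipyramidal_prism_vertices" for p
    using vertex_image_bound that by blast
  then have "bipyramidal_prism_vertices \<subseteq> {p. norm (blinfun_apply T (coord p)) \<le> 2 * ?v}"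
    by (auto simp: TA A_mat)
  moreover have "convex {p. norm (blinfun_apply T (coord p)) \<le> 2 * ?v}"
    using convex_linear_vimage[OF T_lin convex_cball[of 0 "2 * ?v"]] by (simp add: vimage_def)
  ultimately have "convex hull bipyramidal_prism_vertices
      \<subseteq> {p. norm (blinfun_apply T (coord p)) \<le> 2 * ?v}"
    by (rule hull_minimal)
  then have ball: "norm (blinfun_apply T (coord p)) \<le> 2 * ?v" if "prism_norm p \<le> 1" for p
    using that by (auto simp: convex_hull_bipyramidal_prism)
  have unit: "norm (blinfun_apply T x) \<le> 2 * ?v" if "norm x \<le> 1" for x
    using ball[of "inv coord x"] nrm[of "inv coord x"] that by (simp add: coord_inv)
  show ?thesis
  proof (rule norm_blinfun_bound)
    show "0 \<le> 2 * ?v"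
      using unit[of 0] by simp
    fix x
    show "norm (blinfun_apply T x) \<le> 2 * ?v * norm x"
    proof (cases "x = 0")
      case False
      have "norm (blinfun_apply T ((1 / norm x) *\<^sub>R x)) \<le> 2 * ?v"
        using False by (intro unit) simp
      then show ?thesis
        using False by (simp add: blinfun.scaleR_right field_simps)
    qed simp
  qed
qed

section \<open>An extremal operator\<close>

text \<open>
  The matrix \<open>(0, 0, -1), (0, 0, -1), (2, 1, 0)\<close> turns the estimates of the lower bound into
  equalities with \<open>v = 1\<close>; it maps \<open>(1, 1, 1)\<close> to \<open>(-1, -1, 3)\<close>, which has norm \<open>2\<close>. Halving it
  normalises the operator norm to \<open>1\<close>.
\<close>
definition extremal_map :: "real ^ 3 \<Rightarrow> real ^ 3" where
  "extremal_map p = vector [- p $ 3 / 2, - p $ 3 / 2, p $ 1 + p $ 2 / 2]"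

lemma linear_extremal_map: "linear extremal_map"
  by (rule linearI) (simp_all add: extremal_map_def vec_eq_iff forall_3 field_simps)

lemma prism_norm_extremal_map_le: "prism_norm (extremal_map p) \<le> prism_norm p"
proof -
  obtain c where c: "prism_norm p = c"
    by simp
  then have "\<bar>p $ 1\<bar> \<le> c" "\<bar>p $ 2\<bar> \<le> c" "\<bar>p $ 1\<bar> + \<bar>p $ 3\<bar> \<le> 2 * c" "\<bar>p $ 2\<bar> + \<bar>p $ 3\<bar> \<le> 2 * c"
    using prism_norm_le_iff[of p c] by auto
  then have "prism_norm (extremal_map p) \<le> c"
    unfolding prism_norm_le_iff extremal_map_def vector_3 by (intro conjI; linarith)
  then show ?thesis
    by (simp add: c)
qed

text \<open>
  For \<open>0 \<le> t \<le> 1\<close> every halfspace inequality of \<open>p + t T p\<close> is a nonnegative combination of those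
  of \<open>p\<close>. For instance \<open>x - t z / 2 = (1 - t / 2) x + (t / 2) (x - z) \<le> 1 + t / 2\<close>, and the sum of
  the first and third coordinates is \<open>(1 - t / 2) (x + z) + (3 t / 2) x + (t / 2) y \<le> 2 + t\<close>. The
  choice \<open>t = 1 / 4\<close> is one of many.
\<close>
lemma prism_norm_extremal_map_perturbation:
  assumes "prism_norm p \<le> 1" "\<bar>\<epsilon>\<bar> = 1"
  shows "prism_norm (p + (\<epsilon> / 4) *\<^sub>R extremal_map p) \<le> 1 + 1 / 4 * (1 / 2)"
proof -
  consider "\<epsilon> = 1" | "\<epsilon> = -1"
    using assms(2) by linarith
  then show ?thesis
  proof cases
    case 1
    show ?thesis
      using assms(1)
      unfolding prism_norm_le_iff_halfspaces extremal_map_def vector_3 vector_add_component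
        vector_scaleR_component real_scaleR_def 1
      by - (elim conjE, intro conjI; simp add: field_simps; linarith)
  next
    case 2
    show ?thesis
      using assms(1)
      unfolding prism_norm_le_iff_halfspaces extremal_map_def vector_3 vector_add_component
        vector_scaleR_component real_scaleR_def 2
      by - (elim conjE, intro conjI; simp add: field_simps; linarith)
  qed
qed

lemma extremal_operator:
  fixes coord :: "real ^ 3 \<Rightarrow> 'a::real_normed_vector"
  assumes lin: "linear coord" and bij: "bij coord"
    and nrm: "\<And>p. norm (coord p) = prism_norm p"
  obtains T :: "'a \<Rightarrow>\<^sub>L 'a" where "norm T = 1" "numerical_radius T \<le> 1 / 2"
proof -
  let ?F = "\<lambda>x. coord (extremal_map (inv coord x))"
  have inv_lin: "linear (inv coord)"
    using lin bij by (rule linear_inv)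
  have coord_inv: "coord (inv coord x) = x" for x
    using bij by (simp add: bij_is_surj surj_f_inv_f)
  have nx: "prism_norm (inv coord x) = norm x" for x
    using nrm[of "inv coord x"] by (simp add: coord_inv)
  have bnd: "norm (?F x) \<le> norm x" for x
    using prism_norm_extremal_map_le[of "inv coord x"] by (simp add: nrm nx)
  have "bounded_linear ?F"
    using bnd by (intro bounded_linear_intro[where K = 1])
      (simp_all add: linear_add[OF inv_lin] linear_scale[OF inv_lin] linear_add[OF lin]
        linear_scale[OF lin] linear_add[OF linear_extremal_map] linear_scale[OF linear_extremal_map])
  then have ap: "blinfun_apply (Blinfun ?F) = ?F"
    by (rule bounded_linear_Blinfun_apply)
  define T where "T = Blinfun ?F"
  have T: "blinfun_apply T x = ?F x" for x
    by (simp add: T_def ap)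
  have "norm T \<le> 1"
    by (rule norm_blinfun_bound) (simp_all add: T bnd)
  moreover have "1 \<le> norm T"
  proof -
    have "prism_norm (vector [1, 1, 1]) = 1"
      "prism_norm (extremal_map (vector [1, 1, 1])) = 1"
      by (simp_all add: prism_norm_def extremal_map_def)
    then show ?thesis
      using norm_blinfun[of T "coord (vector [1, 1, 1])"] bij
      by (simp add: T nrm bij_is_inj)
  qed
  moreover have "numerical_radius T \<le> 1 / 2"
  proof -
    have axis: "\<bar>axis 1 1 \<bullet> q\<bar> \<le> prism_norm q" for q :: "real ^ 3"
      using prism_norm_le_iff[of q "prism_norm q"] by (simp add: inner_axis')
    have "axis 1 1 \<bullet> (axis 1 1 :: real ^ 3) = 1" "prism_norm (axis 1 1) \<le> 1"
      by (simp_all only: inner_axis_axis prism_norm_le_iff) (simp_all add: axis_def)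
    then obtain x' :: "'a \<Rightarrow>\<^sub>L real" where pair: "norm (coord (axis 1 1)) = 1" "norm x' = 1"
      "blinfun_apply x' (coord (axis 1 1)) = 1"
      using supporting_functional[OF lin bij nrm axis] by blast
    have pert: "norm (x + (\<epsilon> / 4) *\<^sub>R blinfun_apply T x) \<le> 1 + 1 / 4 * (1 / 2)"
      if "norm x = 1" "\<bar>\<epsilon>\<bar> = 1" for x \<epsilon>
    proof -
      have "x + (\<epsilon> / 4) *\<^sub>R blinfun_apply T x =
          coord (inv coord x + (\<epsilon> / 4) *\<^sub>R extremal_map (inv coord x))"
        by (simp only: T linear_add[OF lin] linear_scale[OF lin] coord_inv)
      then show ?thesis
        using prism_norm_extremal_map_perturbation[of "inv coord x" \<epsilon>] that
        by (simp only: nrm nx order_refl)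
    qed
    show ?thesis
      by (rule numerical_radius_le[OF pair, of "1 / 4"])
        (use pert[of _ 1] pert[of _ "-1"] in \<open>simp_all\<close>)
  qed
  ultimately show thesis
    by (intro that[of T]) simp_all
qed

section \<open>The numerical index\<close>

theorem theorem2p8:
  fixes coord :: "real ^ 3 \<Rightarrow> 'a::banach"
  assumes "linear coord" and "bij coord"
    and "polyhedral TYPE('a)"
    and "(unit_ball_vertices :: 'a set) = coord ` bipyramidal_prism_vertices"
  shows "numerical_index TYPE('a) = 1 / 2"
proof -
  have nrm: "norm (coord p) = prism_norm p" for p
    using norm_eq_prism_norm[OF assms(1,2)] assms(4) by (simp add: unit_ball_vertices_def)
  have lower: "1 / 2 \<le> numerical_radius T" if "norm T = 1" for T :: "'a \<Rightarrow>\<^sub>L 'a"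
    using norm_le_twice_numerical_radius[OF assms(1,2) nrm, of T] that by simp
  obtain T :: "'a \<Rightarrow>\<^sub>L 'a" where T: "norm T = 1" "numerical_radius T \<le> 1 / 2"
    by (rule extremal_operator[OF assms(1,2) nrm])
  show ?thesis
    unfolding numerical_index_def
  proof (rule cInf_eq_minimum)
    have "numerical_radius T = 1 / 2"
      using T lower[of T] by simp
    then show "1 / 2 \<in> {numerical_radius T |T :: 'a \<Rightarrow>\<^sub>L 'a. norm T = 1}"
      using T(1) by (metis (mono_tags, lifting) mem_Collect_eq)
  qed (use lower in auto)
qed

end
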